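(* Let $K$ be a positive, nontrivial semiring containing non-zero elements $a,b$ with $a+b=a$. Then the axiomatization $\mathcal A_{UIND^*}$, consisting of the axioms $\emptyset\vdash x\subseteq^*x$ and $\{x\subseteq^*y,\ y\subseteq^*z\}\vdash x\subseteq^*z$ ($x,y,z$ single variables), is sound and complete for the implication problem for unary marginal distribution inclusion atoms over $K$: for every finite set of variables $D$ and every finite set $\Sigma\cup\{\tau\}$ of atoms of the form $x\subseteq^*y$ with $x,y\in D$, $\Sigma\vdash_{\mathcal A_{UIND^*}}\tau$ iff $\Sigma\models_K\tau$.
   Context: Semirings $(K,+,\times,0,1)$: $(K,+,0)$ commutative monoid, $(K,\times,1)$ monoid, two-sided distributivity, $0\times a=a\times0=0$. Positive: $a+b=0\Rightarrow a=b=0$, $a\times b=0\Rightarrow a=0$ or $b=0$. $K$-teams: $D$ finite set of variables, $A$ finite set of values, $X$ finite set of assignments $s:D\to A$, $\mathbb X:X\to K$. For $x\in D$, $a\in A$: $|\mathbb X_{x=a}|=\sum_{s\in X,\,s(x)=a}\mathbb X(s)$ (empty sum $0$), $X(x)=\{a\in A:|\mathbb X_{x=a}|\ne0\}$. $\mathbb X\models x\subseteq^*y$ iff the multiset $\{\{|\mathbb X_{x=a}|:a\in X(x)\}\}$ is contained in the multiset $\{\{|\mathbb X_{y=a}|:a\in X(y)\}\}$ (each element occurs in the first at most as often as in the second). $\Sigma\models_K\tau$: every $K$-team over $D$ satisfying all atoms of $\Sigma$ satisfies $\tau$. Deduction: $\Sigma\vdash_{\mathcal A}\sigma$ iff there is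 a sequence $\tau_1,\dots,\tau_n=\sigma$ with each $\tau_i\in\Sigma$ or $\tau_i\in\Gamma$ for an instance $\Lambda\vdash\Gamma$ of an axiom of $\mathcal A$ with $\Lambda\subseteq\Sigma\cup\{\tau_1,\dots,\tau_{i-1}\}$. *)

theory Defs
  imports "HOL-Library.Multiset" "HOL-Library.FuncSet"
begin

text \<open>
  The class \<^class>\<open>semiring_0\<close> lacks only the unit; \<^class>\<open>semiring_1\<close> has a multiplicative unit
  with \<open>0 \<noteq> 1\<close>, so it is the class of nontrivial semirings. Multiplication need not commute.
\<close>

definition positive_semiring :: "'k::semiring_0 itself \<Rightarrow> bool" where
  "positive_semiring K \<longleftrightarrow>
     (\<forall>a b :: 'k. a + b = 0 \<longrightarrow> a = 0 \<and> b = 0) \<and>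
     (\<forall>a b :: 'k. a * b = 0 \<longrightarrow> a = 0 \<or> b = 0)"

text \<open>
  Weights are total functions, but only their values on the assignments of the team are ever used.
  Assignments \<open>D \<rightarrow> A\<close> are extensional functions, so that distinct elements of \<open>assigns\<close> differ on \<open>D\<close>.
\<close>

record ('x, 'v, 'k) team =
  vals :: "'v set"
  assigns :: "('x \<Rightarrow> 'v) set"
  weight :: "('x \<Rightarrow> 'v) \<Rightarrow> 'k"

definition team_over :: "'x set \<Rightarrow> ('x, 'v, 'k::semiring_0) team \<Rightarrow> bool" where
  "team_over D T \<longleftrightarrow>
     finite D \<and> finite (vals T) \<and> finite (assigns T) \<and> assigns T \<subseteq> D \<rightarrow>\<^sub>E vals T"

definition marginal :: "('x, 'v, 'k::semiring_0) team \<Rightarrow> 'x \<Rightarrow> 'v \<Rightarrow> 'k" where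
  "marginal T x a = (\<Sum>s \<in> {s \<in> assigns T. s x = a}. weight T s)"

definition var_values :: "('x, 'v, 'k::semiring_0) team \<Rightarrow> 'x \<Rightarrow> 'v set" where
  "var_values T x = {a \<in> vals T. marginal T x a \<noteq> 0}"

definition marginal_mset :: "('x, 'v, 'k::semiring_0) team \<Rightarrow> 'x \<Rightarrow> 'k multiset" where
  "marginal_mset T x = image_mset (marginal T x) (mset_set (var_values T x))"

text \<open>\<open>MDIncl x y\<close> is the unary marginal distribution inclusion atom \<open>x \<subseteq>\<^sup>* y\<close>.\<close>

datatype 'x atom = MDIncl 'x 'x

definition atoms_over :: "'x set \<Rightarrow> 'x atom set" where
  "atoms_over D = {MDIncl x y | x y. x \<in> D \<and> y \<in> D}"

fun sat :: "('x, 'v, 'k::semiring_0) team \<Rightarrow> 'x atom \<Rightarrow> bool" where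
  "sat T (MDIncl x y) \<longleftrightarrow> marginal_mset T x \<subseteq># marginal_mset T y"

text \<open>
  HOL cannot quantify over all sets of values at once, so the universe of values is a type
  parameter; with an infinite \<open>'v\<close>, every finite set of values has a copy in \<open>'v\<close>, and
  satisfaction is invariant under injective renaming of values.
\<close>

definition entails ::
  "'k::semiring_0 itself \<Rightarrow> 'v itself \<Rightarrow> 'x set \<Rightarrow> 'x atom set \<Rightarrow> 'x atom \<Rightarrow> bool" where
  "entails K V D \<Sigma> \<tau> \<longleftrightarrow>
     (\<forall>T :: ('x, 'v, 'k) team. team_over D T \<longrightarrow> (\<forall>\<sigma>\<in>\<Sigma>. sat T \<sigma>) \<longrightarrow> sat T \<tau>)"

text \<open>
  An axiomatization is the set of its instances; a pair \<open>(\<Lambda>, \<Gamma>)\<close> stands for \<open>\<Lambda> \<turnstile> \<Gamma>\<close>.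
\<close>

definition derives :: "('f set \<times> 'f set) set \<Rightarrow> 'f set \<Rightarrow> 'f \<Rightarrow> bool" where
  "derives \<A> \<Sigma> \<sigma> \<longleftrightarrow>
     (\<exists>\<tau>s. \<tau>s \<noteq> [] \<and> last \<tau>s = \<sigma> \<and>
        (\<forall>i < length \<tau>s. \<tau>s ! i \<in> \<Sigma> \<or>
           (\<exists>(\<Lambda>, \<Gamma>) \<in> \<A>. \<tau>s ! i \<in> \<Gamma> \<and> \<Lambda> \<subseteq> \<Sigma> \<union> set (take i \<tau>s))))"

definition ax_UIND :: "'x set \<Rightarrow> ('x atom set \<times> 'x atom set) set" where
  "ax_UIND D =
     {({}, {MDIncl x x}) | x. x \<in> D} \<union>
     {({MDIncl x y, MDIncl y z}, {MDIncl x z}) | x y z. x \<in> D \<and> y \<in> D \<and> z \<in> D}"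

end

theory Submission
  imports Defs
begin

text \<open>
  Satisfaction of \<open>\<subseteq>\<^sup>*\<close> is reflexive and transitive, which gives soundness. For completeness,
  suppose \<open>x \<subseteq>\<^sup>* y\<close> is not derivable, and let \<open>U\<close> be the set of all \<open>u\<close> with \<open>x \<subseteq>\<^sup>* u\<close> derivable.
  Take two assignments of weights \<open>a\<close> and \<open>b\<close> that differ exactly on \<open>U\<close>. Since \<open>a + b = a\<close>,
  variables outside \<open>U\<close> have the marginals \<open>{{a}}\<close>, and those in \<open>U\<close> have \<open>{{a, b}}\<close>. An atom is then
  violated only if it leads from \<open>U\<close> to its complement, as \<open>x \<subseteq>\<^sup>* y\<close> does but no atom of \<open>\<Sigma>\<close>.
\<close>

text \<open>The stepwise condition is kept apart from nonemptiness and from the last entry, so that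
  the empty sequence qualifies and sequences can be concatenated.\<close>

definition derivation :: "('f set \<times> 'f set) set \<Rightarrow> 'f set \<Rightarrow> 'f list \<Rightarrow> bool" where
  "derivation \<A> \<Sigma> \<tau>s \<longleftrightarrow>
     (\<forall>i < length \<tau>s. \<tau>s ! i \<in> \<Sigma> \<or>
        (\<exists>(\<Lambda>, \<Gamma>) \<in> \<A>. \<tau>s ! i \<in> \<Gamma> \<and> \<Lambda> \<subseteq> \<Sigma> \<union> set (take i \<tau>s)))"

lemma derives_iff_derivation:
  "derives \<A> \<Sigma> \<sigma> \<longleftrightarrow> (\<exists>\<tau>s. \<tau>s \<noteq> [] \<and> last \<tau>s = \<sigma> \<and> derivation \<A> \<Sigma> \<tau>s)"
  by (simp add: derives_def derivation_def)

lemma derivation_Nil: "derivation \<A> \<Sigma> []"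
  by (simp add: derivation_def)

text \<open>Prefixing a derivation only enlarges the stock of earlier formulas, so every step of the
  second one remains justified.\<close>

lemma derivation_append:
  assumes "derivation \<A> \<Sigma> \<tau>s" "derivation \<A> \<Sigma> \<upsilon>s"
  shows "derivation \<A> \<Sigma> (\<tau>s @ \<upsilon>s)"
  unfolding derivation_def
proof (intro allI impI)
  fix i assume i: "i < length (\<tau>s @ \<upsilon>s)"
  show "(\<tau>s @ \<upsilon>s) ! i \<in> \<Sigma> \<or>
    (\<exists>(\<Lambda>, \<Gamma>) \<in> \<A>. (\<tau>s @ \<upsilon>s) ! i \<in> \<Gamma> \<and> \<Lambda> \<subseteq> \<Sigma> \<union> set (take i (\<tau>s @ \<upsilon>s)))"
  proof (cases "i < length \<tau>s")
    case True
    then show ?thesis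
      using assms(1) by (simp add: derivation_def nth_append)
  next
    case False
    then have "\<upsilon>s ! (i - length \<tau>s) \<in> \<Sigma> \<or> (\<exists>(\<Lambda>, \<Gamma>) \<in> \<A>. \<upsilon>s ! (i - length \<tau>s) \<in> \<Gamma> \<and>
        \<Lambda> \<subseteq> \<Sigma> \<union> set (take (i - length \<tau>s) \<upsilon>s))"
      using assms(2) i by (simp add: derivation_def)
    with False show ?thesis
      by (fastforce simp: nth_append)
  qed
qed

lemma derivation_snoc:
  assumes "derivation \<A> \<Sigma> \<tau>s"
    and "\<sigma> \<in> \<Sigma> \<or> (\<exists>(\<Lambda>, \<Gamma>) \<in> \<A>. \<sigma> \<in> \<Gamma> \<and> \<Lambda> \<subseteq> \<Sigma> \<union> set \<tau>s)"
  shows "derivation \<A> \<Sigma> (\<tau>s @ [\<sigma>])"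
  using assms by (auto simp: derivation_def nth_append less_Suc_eq)

lemma derives_assumption: "\<sigma> \<in> \<Sigma> \<Longrightarrow> derives \<A> \<Sigma> \<sigma>"
  unfolding derives_iff_derivation
  using derivation_snoc[OF derivation_Nil, of \<sigma> \<Sigma> \<A>] by fastforce

text \<open>Each premise comes with a derivation of its own; concatenating them puts all premises
  into one sequence. As sequences are finite lists, \<open>\<Lambda>\<close> is taken
  finite.\<close>

lemma derivation_covering:
  assumes "finite \<Lambda>" "\<And>\<delta>. \<delta> \<in> \<Lambda> \<Longrightarrow> derives \<A> \<Sigma> \<delta>"
  shows "\<exists>\<tau>s. derivation \<A> \<Sigma> \<tau>s \<and> \<Lambda> \<subseteq> set \<tau>s"
  using assms
proof (induction \<Lambda> rule: finite_induct)
  case empty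
  then show ?case using derivation_Nil by auto
next
  case (insert \<delta> \<Lambda>)
  then obtain \<tau>s where "derivation \<A> \<Sigma> \<tau>s" "\<Lambda> \<subseteq> set \<tau>s" by auto
  moreover obtain \<upsilon>s where "derivation \<A> \<Sigma> \<upsilon>s" "\<upsilon>s \<noteq> []" "last \<upsilon>s = \<delta>"
    using insert.prems[of \<delta>] by (auto simp: derives_iff_derivation)
  ultimately have "derivation \<A> \<Sigma> (\<tau>s @ \<upsilon>s)" "insert \<delta> \<Lambda> \<subseteq> set (\<tau>s @ \<upsilon>s)"
    using derivation_append last_in_set[of \<upsilon>s] by auto
  then show ?case by blast
qed

text \<open>Closure of derivability under axiom instances: from here on, new derivations can be
  obtained without handling sequences.\<close>

lemma derives_axiom:
  assumes "(\<Lambda>, \<Gamma>) \<in> \<A>" "\<sigma> \<in> \<Gamma>" "finite \<Lambda>" "\<And>\<delta>. \<delta> \<in> \<Lambda> \<Longrightarrow> derives \<A> \<Sigma> \<delta>"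
  shows "derives \<A> \<Sigma> \<sigma>"
proof -
  obtain \<tau>s where "derivation \<A> \<Sigma> \<tau>s" "\<Lambda> \<subseteq> set \<tau>s"
    using derivation_covering[OF assms(3,4)] by blast
  then have "derivation \<A> \<Sigma> (\<tau>s @ [\<sigma>])"
    using assms(1,2) by (intro derivation_snoc) auto
  then show ?thesis
    unfolding derives_iff_derivation by (intro exI[of _ "\<tau>s @ [\<sigma>]"]) simp
qed

lemma derives_UIND_refl:
  assumes "x \<in> D"
  shows "derives (ax_UIND D) \<Sigma> (MDIncl x x)"
  by (rule derives_axiom[of "{}" "{MDIncl x x}"]) (use assms in \<open>auto simp: ax_UIND_def\<close>)

lemma derives_UIND_trans:
  assumes "derives (ax_UIND D) \<Sigma> (MDIncl x y)" "derives (ax_UIND D) \<Sigma> (MDIncl y z)"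
    and "x \<in> D" "y \<in> D" "z \<in> D"
  shows "derives (ax_UIND D) \<Sigma> (MDIncl x z)"
  by (rule derives_axiom[of "{MDIncl x y, MDIncl y z}" "{MDIncl x z}"])
    (use assms in \<open>auto simp: ax_UIND_def\<close>)

text \<open>Strong induction on the position: a step may use any earlier entry, not just its
  predecessor. Later, \<open>P\<close> is satisfaction in one fixed team.\<close>

lemma derivation_sound:
  assumes "derivation \<A> \<Sigma> \<tau>s" "\<And>\<sigma>. \<sigma> \<in> \<Sigma> \<Longrightarrow> P \<sigma>"
    and "\<And>\<Lambda> \<Gamma> \<gamma>. (\<Lambda>, \<Gamma>) \<in> \<A> \<Longrightarrow> (\<And>\<delta>. \<delta> \<in> \<Lambda> \<Longrightarrow> P \<delta>) \<Longrightarrow> \<gamma> \<in> \<Gamma> \<Longrightarrow> P \<gamma>"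
    and "i < length \<tau>s"
  shows "P (\<tau>s ! i)"
  using assms(4)
proof (induction i rule: less_induct)
  case (less i)
  consider "\<tau>s ! i \<in> \<Sigma>"
    | \<Lambda> \<Gamma> where "(\<Lambda>, \<Gamma>) \<in> \<A>" "\<tau>s ! i \<in> \<Gamma>" "\<Lambda> \<subseteq> \<Sigma> \<union> set (take i \<tau>s)"
    using assms(1) less.prems unfolding derivation_def by blast
  then show ?case
  proof cases
    case 1
    then show ?thesis by (rule assms(2))
  next
    case 2
    \<comment> \<open>An entry of \<open>take i \<tau>s\<close> is some \<open>\<tau>s ! j\<close>
      with \<open>j < i\<close>, where the induction hypothesis applies.\<close>
    have "P \<delta>" if "\<delta> \<in> \<Sigma> \<union> set (take i \<tau>s)" for \<delta>
      using that assms(2) less by (auto simp: in_set_conv_nth)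
    with 2 show ?thesis using assms(3) by blast
  qed
qed

lemma derives_sound:
  assumes "derives \<A> \<Sigma> \<sigma>" "\<And>\<sigma>. \<sigma> \<in> \<Sigma> \<Longrightarrow> P \<sigma>"
    and "\<And>\<Lambda> \<Gamma> \<gamma>. (\<Lambda>, \<Gamma>) \<in> \<A> \<Longrightarrow> (\<And>\<delta>. \<delta> \<in> \<Lambda> \<Longrightarrow> P \<delta>) \<Longrightarrow> \<gamma> \<in> \<Gamma> \<Longrightarrow> P \<gamma>"
  shows "P \<sigma>"
proof -
  obtain \<tau>s where \<tau>s: "derivation \<A> \<Sigma> \<tau>s" "\<tau>s \<noteq> []" "last \<tau>s = \<sigma>"
    using assms(1) by (auto simp: derives_iff_derivation)
  have "P (\<tau>s ! (length \<tau>s - 1))"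
  proof (rule derivation_sound[OF \<tau>s(1)])
    show "P \<gamma>" if "(\<Lambda>, \<Gamma>) \<in> \<A>" "\<And>\<delta>. \<delta> \<in> \<Lambda> \<Longrightarrow> P \<delta>" "\<gamma> \<in> \<Gamma>" for \<Lambda> \<Gamma> \<gamma>
      using that by (rule assms(3))
  qed (use assms(2) \<tau>s(2) in auto)
  with \<tau>s show ?thesis by (simp add: last_conv_nth)
qed

lemma ax_UIND_sound:
  assumes "derives (ax_UIND D) \<Sigma> \<sigma>" "\<And>\<sigma>. \<sigma> \<in> \<Sigma> \<Longrightarrow> sat T \<sigma>"
  shows "sat T \<sigma>"
  using assms(1,2)
proof (rule derives_sound[where P = "sat T"])
  fix \<Lambda> \<Gamma> \<gamma>
  assume ax: "(\<Lambda>, \<Gamma>) \<in> ax_UIND D" and "\<And>\<delta>. \<delta> \<in> \<Lambda> \<Longrightarrow> sat T \<delta>" and \<gamma>: "\<gamma> \<in> \<Gamma>"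
  then have "\<forall>\<delta>\<in>\<Lambda>. sat T \<delta>" by blast
  with ax \<gamma> show "sat T \<gamma>"
    unfolding ax_UIND_def by (auto intro: subset_mset.order_trans)
qed

text \<open>For \<open>U = {}\<close> this is constantly \<open>p\<close> on \<open>D\<close>, so
  one definition yields both assignments of the team below.\<close>

definition step_assign :: "'x set \<Rightarrow> 'x set \<Rightarrow> 'v \<Rightarrow> 'v \<Rightarrow> 'x \<Rightarrow> 'v" where
  "step_assign D U p q = (\<lambda>u\<in>D. if u \<in> U then q else p)"

definition two_point_team ::
  "'x set \<Rightarrow> 'x set \<Rightarrow> 'v \<Rightarrow> 'v \<Rightarrow> 'k \<Rightarrow> 'k \<Rightarrow> ('x, 'v, 'k::semiring_0) team" where
  "two_point_team D U p q a b =
     \<lparr>vals = {p, q}, assigns = {step_assign D {} p q, step_assign D U p q},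
      weight = (\<lambda>s. if s = step_assign D U p q then b else a)\<rparr>"

lemma team_over_two_point: "finite D \<Longrightarrow> team_over D (two_point_team D U p q a b)"
  by (auto simp: team_over_def two_point_team_def step_assign_def)

text \<open>The variable \<open>x\<close> witnesses that \<open>U\<close> meets \<open>D\<close>.
  Together with \<open>p \<noteq> q\<close> this keeps the two assignments distinct; otherwise the
  team would collapse to one assignment of weight \<open>b\<close>.\<close>

lemma marginal_two_point:
  assumes "x \<in> U" "x \<in> D" "p \<noteq> q" "u \<in> D"
  shows "marginal (two_point_team D U p q a b) u c =
    (if c = p then a else 0) + (if c = (if u \<in> U then q else p) then b else 0)"
proof -
  let ?s = "step_assign D {} p q" and ?t = "step_assign D U p q"
  have ne: "?s \<noteq> ?t"
    using assms(1-3) by (auto simp: step_assign_def fun_eq_iff)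
  \<comment> \<open>Replacing the filter by an indicator leaves a sum over an explicit pair.\<close>
  have "marginal (two_point_team D U p q a b) u c =
      (\<Sum>s\<in>{?s, ?t}. if s u = c then if s = ?t then b else a else 0)"
    unfolding marginal_def two_point_team_def team.simps
    by (subst sum.inter_filter) auto
  also have "\<dots> = (if ?s u = c then a else 0) + (if ?t u = c then b else 0)"
    using ne by simp
  finally show ?thesis
    using assms(4) by (auto simp: step_assign_def)
qed

text \<open>On \<open>U\<close> the values \<open>p\<close> and \<open>q\<close> have marginals
  \<open>a\<close> and \<open>b\<close>. Off \<open>U\<close> both assignments take the value
  \<open>p\<close>, whose marginal is \<open>a + b = a\<close>, while \<open>q\<close> has marginal
  0 and drops out.\<close>

lemma marginal_mset_two_point:
  fixes a b :: "'k::semiring_0"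
  assumes "x \<in> U" "x \<in> D" "p \<noteq> q" "u \<in> D" "a \<noteq> 0" "b \<noteq> 0" "a + b = a"
  shows "marginal_mset (two_point_team D U p q a b) u = (if u \<in> U then {#a, b#} else {#a#})"
proof -
  note m = marginal_two_point[OF assms(1-4), of a b]
  have "var_values (two_point_team D U p q a b) u = (if u \<in> U then {p, q} else {p})"
    using assms unfolding var_values_def m by (auto simp: two_point_team_def)
  then show ?thesis
    using assms(3,7) by (auto simp: marginal_mset_def m)
qed

lemma ax_UIND_complete:
  fixes a b :: "'k::semiring_0"
  assumes "a \<noteq> 0" "b \<noteq> 0" "a + b = a"
    and "(p :: 'v) \<noteq> q"
    and "finite D" "\<Sigma> \<union> {\<tau>} \<subseteq> atoms_over D"
    and "entails TYPE('k) TYPE('v) D \<Sigma> \<tau>"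
  shows "derives (ax_UIND D) \<Sigma> \<tau>"
proof (rule ccontr)
  assume not: "\<not> derives (ax_UIND D) \<Sigma> \<tau>"
  obtain x y where \<tau>: "\<tau> = MDIncl x y" and D: "x \<in> D" "y \<in> D"
    using assms(6) by (auto simp: atoms_over_def)
  define U where "U = {u \<in> D. derives (ax_UIND D) \<Sigma> (MDIncl x u)}"
  define T where "T = two_point_team D U p q a b"
  have "x \<in> U" "y \<notin> U"
    using D not derives_UIND_refl by (auto simp: U_def \<tau>)
  note m = marginal_mset_two_point[OF \<open>x \<in> U\<close> D(1) assms(4) _ assms(1-3), folded T_def]
  have "sat T \<sigma>" if "\<sigma> \<in> \<Sigma>" for \<sigma>
  proof -
    have "\<sigma> \<in> atoms_over D"
      using assms(6) that by blast
    then obtain u v where \<sigma>: "\<sigma> = MDIncl u v" and uv: "u \<in> D" "v \<in> D"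
      by (auto simp: atoms_over_def)
    \<comment> \<open>Prolonging a derivation of \<open>MDIncl x u\<close> by the assumption
      \<open>MDIncl u v\<close> shows that \<open>U\<close> is closed under the atoms of
      \<open>\<Sigma>\<close>.\<close>
    have "u \<in> U \<Longrightarrow> v \<in> U"
      using derives_UIND_trans[of D \<Sigma> x u v] derives_assumption[OF that] uv D
      by (auto simp: U_def \<sigma>)
    then show ?thesis using uv by (auto simp: \<sigma> m)
  qed
  moreover have "team_over D T"
    using assms(5) by (simp add: T_def team_over_two_point)
  ultimately have "sat T \<tau>"
    using assms(7) by (simp add: entails_def)
  then show False
    \<comment> \<open>Comparing sizes, two against one, settles this even when \<open>a = b\<close>,
      where the multisets differ only in multiplicity.\<close>
    using \<open>x \<in> U\<close> \<open>y \<notin> U\<close> D by (auto simp: \<tau> m dest: size_mset_mono)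
qed

theorem theorem5:
  fixes a b :: "'k::semiring_1"
    and D :: "'x set"
    and \<Sigma> :: "'x atom set"
    and \<tau> :: "'x atom"
  assumes "positive_semiring TYPE('k)"
    and "a \<noteq> 0" and "b \<noteq> 0" and "a + b = a"
    and "infinite (UNIV :: 'v set)"
    and "finite D"
    and "finite \<Sigma>"
    and "\<Sigma> \<union> {\<tau>} \<subseteq> atoms_over D"
  shows "derives (ax_UIND D) \<Sigma> \<tau> \<longleftrightarrow> entails TYPE('k) TYPE('v) D \<Sigma> \<tau>"
proof
  assume "derives (ax_UIND D) \<Sigma> \<tau>"
  then have "sat T \<tau>" if "\<forall>\<sigma>\<in>\<Sigma>. sat T \<sigma>" for T :: "('x, 'v, 'k) team"
    by (rule ax_UIND_sound) (use that in blast)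
  then show "entails TYPE('k) TYPE('v) D \<Sigma> \<tau>"
    by (simp add: entails_def)
next
  assume "entails TYPE('k) TYPE('v) D \<Sigma> \<tau>"
  \<comment> \<open>The counterexample takes two distinct values: \<open>undefined\<close> serves as
    one, and infinity of the value type supplies the other.\<close>
  moreover obtain q :: 'v where "q \<noteq> undefined"
    using ex_new_if_finite[OF assms(5), of "{undefined}"] by auto
  ultimately show "derives (ax_UIND D) \<Sigma> \<tau>"
    by (intro ax_UIND_complete[OF assms(2-4) _ assms(6,8)])
qed

end
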